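(* For the Ising model on the hypercube $\mathcal Q_n$, the set of metastable configurations is $\Omega_m=\{\boxminus\}$.
   Context: $\mathcal Q_n=(V_n,E_n)$ is the $n$-dimensional hypercube graph: $V_n=\{0,1\}^n$, with edges (unoriented) between vertices $v,w$ with $\|v-w\|_1=1$. The configuration space is $\Omega=\{+1,-1\}^{V_n}$, identified with the power set $\mathcal P(V_n)$: a set $A\subseteq V_n$ stands for the configuration that is $+1$ on $A$ and $-1$ on $\overline A=V_n\setminus A$. Write $\boxplus=V_n$ and $\boxminus=\emptyset$. For $U,W\subseteq V_n$, $E(U,W)$ is the set of unoriented edges with one endpoint in $U$ and the other in $W$. The Hamiltonian (interaction parameter equal to $1$) is $$\mathcal H(A)=-\tfrac12\left(|E_n|-2|E(A,\overline A)|\right)-\tfrac{\mathfrak h}{2}\left(|A|-|\overline A|\right).$$ Standing assumption: $0<\mathfrak h<n$ and $\mathfrak h$ is not of the form $a/b$ with $a\in\mathbb N$ and $b\in\{1,2,\ldots,2^n\}$. A path $\gamma:\xi\to\xi'$ in $\Omega$ is a finite sequence of configurations from $\xi$ to $\xi'$ in which consecutive configurations $A,A'$ satisfy $|A\triangle A'|=1$. The communication height is $\Phi(\xi,\xi')=\min_{\gamma:\xi\to\xi'}\max_{\sigma\in\gamma}\mathcal H(\sigma)$. The stability level of $\xi\in\Omega$ is $\mathscr V_\xi=\min_{\zeta:\mathcal H(\zeta)<\mathcal H(\xi)}\Phi(\xi,\zeta)-\mathcal H(\xi)$. The unique minimizer of $\mathcal H$ is $\boxplus$, and the set of metastable configurations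 is $$\Omega_m=\left\{\xi\in\Omega\setminus\{\boxplus\}:\ \mathscr V_\xi=\max_{\zeta\in\Omega\setminus\{\boxplus\}}\mathscr V_\zeta\right\}.$$ *)

theory Defs
  imports Complex_Main "HOL-Library.FuncSet"
begin

definition cube_vertices :: "nat \<Rightarrow> (nat \<Rightarrow> int) set" where
  "cube_vertices n = {..<n} \<rightarrow>\<^sub>E {0, 1}"

definition cube_edges :: "nat \<Rightarrow> (nat \<Rightarrow> int) set set" where
  "cube_edges n =
     {{v, w} | v w. v \<in> cube_vertices n \<and> w \<in> cube_vertices n \<and> (\<Sum>i<n. \<bar>v i - w i\<bar>) = 1}"

definition edges_between ::
  "nat \<Rightarrow> (nat \<Rightarrow> int) set \<Rightarrow> (nat \<Rightarrow> int) set \<Rightarrow> (nat \<Rightarrow> int) set set" where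
  "edges_between n U W = {e \<in> cube_edges n. \<exists>u\<in>U. \<exists>w\<in>W. e = {u, w}}"

text \<open>A spin configuration is identified with the set of its \<open>+1\<close> vertices.\<close>

type_synonym config = "(nat \<Rightarrow> int) set"

definition configs :: "nat \<Rightarrow> config set" where
  "configs n = Pow (cube_vertices n)"

definition all_plus :: "nat \<Rightarrow> config" where
  "all_plus n = cube_vertices n"

definition all_minus :: config where
  "all_minus = {}"

definition hamiltonian :: "nat \<Rightarrow> real \<Rightarrow> config \<Rightarrow> real" where
  "hamiltonian n h A =
     - (1/2) * (real (card (cube_edges n))
                 - 2 * real (card (edges_between n A (cube_vertices n - A))))
     - h / 2 * (real (card A) - real (card (cube_vertices n - A)))"

definition is_path :: "nat \<Rightarrow> config \<Rightarrow> config \<Rightarrow> config list \<Rightarrow> bool" where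
  "is_path n \<xi> \<xi>' \<gamma> \<longleftrightarrow>
     \<gamma> \<noteq> [] \<and> hd \<gamma> = \<xi> \<and> last \<gamma> = \<xi>' \<and> set \<gamma> \<subseteq> configs n \<and>
     successively (\<lambda>A A'. card (sym_diff A A') = 1) \<gamma>"

definition comm_height :: "nat \<Rightarrow> real \<Rightarrow> config \<Rightarrow> config \<Rightarrow> real" where
  "comm_height n h \<xi> \<xi>' =
     Min {Max (hamiltonian n h ` set \<gamma>) | \<gamma>. is_path n \<xi> \<xi>' \<gamma>}"

text \<open>The set minimised over below is empty exactly when \<open>\<xi>\<close> minimises the Hamiltonian;
  the value is then unspecified, and it is never used in \<open>metastable\<close>.\<close>

definition stability_level :: "nat \<Rightarrow> real \<Rightarrow> config \<Rightarrow> real" where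
  "stability_level n h \<xi> =
     Min {comm_height n h \<xi> \<zeta> | \<zeta>. \<zeta> \<in> configs n \<and> hamiltonian n h \<zeta> < hamiltonian n h \<xi>}
     - hamiltonian n h \<xi>"

definition metastable :: "nat \<Rightarrow> real \<Rightarrow> config set" where
  "metastable n h =
     {\<xi> \<in> configs n - {all_plus n}.
        stability_level n h \<xi> = Max (stability_level n h ` (configs n - {all_plus n}))}"

text \<open>Every \<open>Min\<close> and \<open>Max\<close> above ranges over a finite nonempty set
  (for \<open>h > 0\<close>, \<open>n \<ge> 1\<close>, and \<open>\<xi>\<close> different from \<open>all_plus n\<close>).\<close>

lemma finite_cube_vertices: "finite (cube_vertices n)"
  by (simp add: cube_vertices_def finite_PiE)

lemma finite_configs: "finite (configs n)"
  by (simp add: configs_def finite_cube_vertices)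

lemma finite_comm_height_values:
  "finite {Max (hamiltonian n h ` set \<gamma>) | \<gamma>. is_path n \<xi> \<xi>' \<gamma>}"
proof (rule finite_subset)
  show "{Max (hamiltonian n h ` set \<gamma>) | \<gamma>. is_path n \<xi> \<xi>' \<gamma>} \<subseteq> hamiltonian n h ` configs n"
  proof clarify
    fix \<gamma> assume p: "is_path n \<xi> \<xi>' \<gamma>"
    then have "Max (hamiltonian n h ` set \<gamma>) \<in> hamiltonian n h ` set \<gamma>"
      by (intro Max_in) (auto simp: is_path_def)
    then show "Max (hamiltonian n h ` set \<gamma>) \<in> hamiltonian n h ` configs n"
      using p unfolding is_path_def by (meson image_mono subsetD)
  qed
qed (simp add: finite_configs)

lemma is_path_extend:
  assumes "is_path n \<xi> A \<gamma>" "B \<in> configs n" "card (sym_diff A B) = 1"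
  shows "is_path n \<xi> B (\<gamma> @ [B])"
  using assms by (auto simp: is_path_def successively_append_iff)

lemma is_path_exists:
  assumes "\<xi> \<in> configs n" "\<xi>' \<in> configs n"
  shows "\<exists>\<gamma>. is_path n \<xi> \<xi>' \<gamma>"
proof -
  have fin: "finite (sym_diff \<xi> \<xi>')"
    using assms finite_cube_vertices by (auto simp: configs_def intro: finite_subset)
  have "\<exists>\<gamma>. is_path n \<xi> (sym_diff \<xi> D) \<gamma>" if "finite D" "D \<subseteq> cube_vertices n" for D
    using that
  proof (induction D rule: finite_induct)
    case empty
    show ?case
      using assms by (intro exI[of _ "[\<xi>]"]) (auto simp: is_path_def)
  next
    case (insert x D)
    then obtain \<gamma> where \<gamma>: "is_path n \<xi> (sym_diff \<xi> D) \<gamma>" by auto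
    have "sym_diff (sym_diff \<xi> D) (sym_diff \<xi> (insert x D)) = {x}"
      using insert.hyps by auto
    moreover have "sym_diff \<xi> (insert x D) \<in> configs n"
      using assms insert.prems by (auto simp: configs_def)
    ultimately show ?case
      using is_path_extend[OF \<gamma>] by (metis card_1_singleton_iff One_nat_def)
  qed
  from this[OF fin] have "\<exists>\<gamma>. is_path n \<xi> (sym_diff \<xi> (sym_diff \<xi> \<xi>')) \<gamma>"
    using assms by (auto simp: configs_def)
  moreover have "sym_diff \<xi> (sym_diff \<xi> \<xi>') = \<xi>'" by auto
  ultimately show ?thesis by simp
qed

lemma finite_stability_values:
  "finite {comm_height n h \<xi> \<zeta> | \<zeta>. \<zeta> \<in> configs n \<and> hamiltonian n h \<zeta> < hamiltonian n h \<xi>}"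
  using finite_configs by simp

lemma all_plus_minimizer:
  assumes "h > 0" "\<xi> \<in> configs n" "\<xi> \<noteq> all_plus n"
  shows "hamiltonian n h (all_plus n) < hamiltonian n h \<xi>"
proof -
  have sub: "\<xi> \<subset> cube_vertices n"
    using assms by (auto simp: configs_def all_plus_def)
  have 1: "edges_between n (cube_vertices n) {} = {}"
    by (auto simp: edges_between_def)
  have "card \<xi> < card (cube_vertices n)"
    using sub finite_cube_vertices psubset_card_mono by blast
  then have "real (card \<xi>) - real (card (cube_vertices n - \<xi>)) < real (card (cube_vertices n))"
    by linarith
  then have "h / 2 * (real (card \<xi>) - real (card (cube_vertices n - \<xi>)))
      < h / 2 * real (card (cube_vertices n))"
    using assms by (intro mult_strict_left_mono) auto
  moreover have "- (1/2) * (e - 2 * 0) - p < - (1/2) * (e - 2 * c) - q"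
    if "q < p" "c \<ge> 0" for e c p q :: real
    using that by (simp add: field_simps)
  ultimately show ?thesis
    unfolding hamiltonian_def all_plus_def Diff_cancel 1 card.empty of_nat_0 diff_0_right
    by (meson of_nat_0_le_iff)
qed

lemma all_minus_in_configs: "all_minus \<in> configs n - {all_plus n}"
proof -
  have "cube_vertices n \<noteq> {}"
    by (simp add: cube_vertices_def PiE_eq_empty_iff)
  then show ?thesis
    by (auto simp: configs_def all_minus_def all_plus_def)
qed

end

theory Submission imports Defs begin

text \<open>
  Write \<open>F A = H A - H {}\<close>. Up to the normalisation \<open>F {} = 0\<close> the energy is the size of the edge
  boundary minus \<open>h\<close> times the volume, so it is submodular, and it is invariant under the translations
  of the cube. Let \<open>\<Gamma>\<close> be the stability level of the all-minus configuration. The theorem amounts to the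
  strict inequality of stability levels in \<open>stability_level_less_all_minus\<close>: from any \<open>A\<close> other
  than the two constant configurations one reaches lower energy while climbing strictly less than
  \<open>\<Gamma>\<close>. This follows from submodularity, vertex transitivity and connectedness of the cube.

  A path of height \<open>\<Gamma>\<close> that leads from the empty set to negative \<open>F\<close> can be made increasing, by
  exchanging neighbouring sets for their unions or intersections
  (\<open>nested_nucleation_exists\<close>). Among these increasing sequences choose \<open>X\<close> with the smallest final
  set, and translate it so that its first vertex \<open>w\<close> lies outside \<open>A\<close> but next to a vertex of \<open>A\<close>.
  Now grow this droplet on top of \<open>A\<close>, that is, follow \<open>A \<union> X i\<close>. Submodularity reads
    \<open>F (A \<union> X i) - F A \<le> F (X i) - F (A \<inter> X i)\<close>,
  so as long as \<open>F (A \<inter> X i) \<ge> 0\<close> the climb is at most \<open>\<Gamma>\<close>, and at the end of the sequence the energy has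
  dropped. If instead \<open>F (A \<inter> X i)\<close> becomes negative before \<open>F (A \<union> X i)\<close> falls below \<open>F A\<close>, then the same
  inequality bounds \<open>F (A \<inter> X j)\<close> by \<open>F (X j) \<le> \<Gamma>\<close>, and the sets \<open>A \<inter> X j\<close> form an increasing sequence
  with a smaller final set, since they miss \<open>w\<close>: a contradiction (\<open>escape_along_union\<close>).

  For nonempty \<open>X i\<close> the climb is strictly less than \<open>\<Gamma>\<close> for one of two reasons. If \<open>X i\<close> meets \<open>A\<close>, then \<open>F (A \<inter> X i)\<close> is
  not zero, because \<open>h\<close> is not a fraction with denominator at most \<open>2 ^ n\<close>. If \<open>X i\<close> is
  disjoint from \<open>A\<close>, then the edge from \<open>w\<close> to \<open>A\<close> lies on both boundaries but not on that of the union.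
\<close>

section \<open>Nucleation sequences for a submodular energy\<close>

text \<open>The condition on consecutive sets restricts only growth: arbitrarily many vertices may be lost
  in one step. This freedom is what makes the class closed under the exchanges used below to reach
  increasing sequences, for which it is no freedom at all.\<close>

definition nucleation :: "('a set \<Rightarrow> real) \<Rightarrow> 'a set \<Rightarrow> real \<Rightarrow> nat \<Rightarrow> (nat \<Rightarrow> 'a set) \<Rightarrow> bool" where
  "nucleation F V \<Gamma> N X \<longleftrightarrow>
     X 0 = {} \<and> (\<forall>i\<le>N. X i \<subseteq> V \<and> F (X i) \<le> \<Gamma>) \<and>
     (\<forall>i<N. card (X (Suc i) - X i) \<le> 1) \<and> F (X N) < 0"

definition submodular_on :: "'a set \<Rightarrow> ('a set \<Rightarrow> real) \<Rightarrow> bool" where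
  "submodular_on V F \<longleftrightarrow>
     (\<forall>A B. A \<subseteq> V \<longrightarrow> B \<subseteq> V \<longrightarrow> F (A \<union> B) + F (A \<inter> B) \<le> F A + F B)"

lemma submodular_onD:
  "\<lbrakk>submodular_on V F; A \<subseteq> V; B \<subseteq> V\<rbrakk> \<Longrightarrow> F (A \<union> B) + F (A \<inter> B) \<le> F A + F B"
  by (simp add: submodular_on_def)

lemma finite_lexicographic_minimum:
  fixes f :: "'a \<Rightarrow> real" and g :: "'a \<Rightarrow> nat"
  assumes "finite S" "S \<noteq> {}"
  obtains x where "x \<in> S" "\<And>y. y \<in> S \<Longrightarrow> f x \<le> f y"
    "\<And>y. \<lbrakk>y \<in> S; f y \<le> f x\<rbrakk> \<Longrightarrow> g x \<le> g y"
proof -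
  obtain z where z: "z \<in> S" "\<And>y. y \<in> S \<Longrightarrow> f z \<le> f y"
    using ex_min_if_finite[of "f ` S"] assms
    by (metis (no_types, lifting) finite_imageI image_is_empty imageE image_eqI linorder_not_less)
  obtain x where x: "x \<in> S \<and> f x \<le> f z" "\<And>y. y \<in> S \<and> f y \<le> f z \<Longrightarrow> g x \<le> g y"
    using ex_has_least_nat[of "\<lambda>x. x \<in> S \<and> f x \<le> f z" z g] z by auto
  show thesis
    by (rule that[of x]) (use x z in \<open>auto intro: order_trans\<close>)
qed

lemma nucleation_fun_upd:
  assumes nuc: "nucleation F V \<Gamma> N X" and i: "i \<le> N"
    and Z: "Z \<subseteq> V" "F Z \<le> F (X i)" "i = 0 \<longrightarrow> Z = {}"
    and prev: "0 < i \<longrightarrow> card (Z - X (i - 1)) \<le> 1"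
    and succ: "i < N \<longrightarrow> card (X (Suc i) - Z) \<le> 1"
  shows "nucleation F V \<Gamma> N (X(i := Z))"
proof -
  have "F Z \<le> \<Gamma>" using nuc i Z(2) by (auto simp: nucleation_def intro: order_trans)
  then show ?thesis
    using assms unfolding nucleation_def by auto
qed

lemma sum_fun_upd_diff:
  fixes f :: "'b \<Rightarrow> 'c::ab_group_add"
  assumes "i \<le> (N::nat)"
  shows "(\<Sum>j\<le>N. f ((X(i := Z)) j)) = (\<Sum>j\<le>N. f (X j)) + f Z - f (X i)"
proof -
  have split: "(\<Sum>j\<le>N. f (W j)) = f (W i) + (\<Sum>j\<in>{..N} - {i}. f (W j))" for W
    using assms by (intro sum.remove) auto
  have "(\<Sum>j\<in>{..N} - {i}. f ((X(i := Z)) j)) = (\<Sum>j\<in>{..N} - {i}. f (X j))"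
    by (rule sum.cong) auto
  then show ?thesis
    using split[of X] split[of "X(i := Z)"] by simp
qed

text \<open>The exchange argument of Bienstock and Seymour for monotone search. Among the sequences of the given
  length, minimise first the total energy and then the total cardinality. Replacing \<open>Y (Suc i)\<close>
  by \<open>Y i \<union> Y (Suc i)\<close> cannot lower the energy; by submodularity, replacing \<open>Y i\<close> by
  \<open>Y i \<inter> Y (Suc i)\<close> then does not raise it, and so, by the second minimisation, changes nothing.\<close>

lemma nested_nucleation_exists:
  assumes fin: "finite V" and sub: "submodular_on V F" and nuc: "nucleation F V \<Gamma> N X"
  obtains Y where "nucleation F V \<Gamma> N Y" "\<And>i. i < N \<Longrightarrow> Y i \<subseteq> Y (Suc i)"
proof -
  define S where "S = {Y \<in> {..N} \<rightarrow>\<^sub>E Pow V. nucleation F V \<Gamma> N Y}"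
  have "finite S"
    unfolding S_def using fin by (auto intro!: finite_Collect_conjI finite_PiE)
  moreover have "restrict X {..N} \<in> S"
    using nuc by (auto simp: S_def nucleation_def)
  ultimately obtain Y where Y: "Y \<in> S"
    and minF: "\<And>Z. Z \<in> S \<Longrightarrow> (\<Sum>j\<le>N. F (Y j)) \<le> (\<Sum>j\<le>N. F (Z j))"
    and minc: "\<And>Z. \<lbrakk>Z \<in> S; (\<Sum>j\<le>N. F (Z j)) \<le> (\<Sum>j\<le>N. F (Y j))\<rbrakk>
                 \<Longrightarrow> (\<Sum>j\<le>N. card (Y j)) \<le> (\<Sum>j\<le>N. card (Z j))"
    using finite_lexicographic_minimum[of S "\<lambda>Y. \<Sum>j\<le>N. F (Y j)" "\<lambda>Y. \<Sum>j\<le>N. card (Y j)"]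
    by (metis empty_iff)
  have nY: "nucleation F V \<Gamma> N Y" using Y by (simp add: S_def)
  have sV: "Y i \<subseteq> V" if "i \<le> N" for i using nY that by (simp add: nucleation_def)
  have inS: "Y(i := Z) \<in> S" if "i \<le> N" "Z \<subseteq> V" "nucleation F V \<Gamma> N (Y(i := Z))" for i Z
    using that Y by (auto simp: S_def PiE_def Pi_def extensional_def)
  have fin': "finite (Y i)" if "i \<le> N" for i using sV[OF that] fin finite_subset by blast
  have "Y i \<subseteq> Y (Suc i)" if i: "i < N" for i
  proof -
    let ?U = "Y i \<union> Y (Suc i)" and ?I = "Y i \<inter> Y (Suc i)"
    have step: "card (Y (Suc j) - Y j) \<le> 1" if "j < N" for j
      using nY that by (simp add: nucleation_def)
    have Vi: "Y i \<subseteq> V" "Y (Suc i) \<subseteq> V" using sV i by auto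
    have "F (Y (Suc i)) \<le> F ?U"
    proof (rule ccontr)
      assume less: "\<not> F (Y (Suc i)) \<le> F ?U"
      have c: "card (Y (Suc (Suc i)) - ?U) \<le> 1" if "Suc i < N"
        using card_mono[of "Y (Suc (Suc i)) - Y (Suc i)" "Y (Suc (Suc i)) - ?U"]
          step[OF that] fin'[of "Suc (Suc i)"] that by (auto intro: order_trans)
      have "?U - Y i = Y (Suc i) - Y i" by blast
      then have "nucleation F V \<Gamma> N (Y(Suc i := ?U))"
        using i less Vi c step[OF i] by (intro nucleation_fun_upd[OF nY]) auto
      then have "Y(Suc i := ?U) \<in> S" using i Vi by (intro inS) auto
      from minF[OF this] show False
        using less i by (subst (asm) sum_fun_upd_diff) auto
    qed
    then have FI: "F ?I \<le> F (Y i)" using submodular_onD[OF sub Vi] by simp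
    have c: "card (?I - Y (i - 1)) \<le> 1" if "0 < i"
      using card_mono[of "Y i - Y (i - 1)" "?I - Y (i - 1)"] step[of "i - 1"] that i fin'[of i]
      by (force intro: order_trans)
    have "Y (Suc i) - ?I = Y (Suc i) - Y i" by blast
    moreover have "Y 0 = {}" using nY by (simp add: nucleation_def)
    ultimately have "nucleation F V \<Gamma> N (Y(i := ?I))"
      using i FI Vi c step[OF i] by (intro nucleation_fun_upd[OF nY]) auto
    then have "Y(i := ?I) \<in> S" using i Vi by (intro inS) auto
    moreover have "(\<Sum>j\<le>N. F ((Y(i := ?I)) j)) \<le> (\<Sum>j\<le>N. F (Y j))"
      using i FI by (subst sum_fun_upd_diff) auto
    ultimately have "(\<Sum>j\<le>N. card (Y j)) \<le> (\<Sum>j\<le>N. card ((Y(i := ?I)) j))"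
      by (rule minc)
    then have "(\<Sum>j\<le>N. int (card (Y j))) \<le> (\<Sum>j\<le>N. int (card ((Y(i := ?I)) j)))"
      by (simp only: of_nat_sum[symmetric] of_nat_le_iff)
    then have "card (Y i) \<le> card ?I"
      using i by (subst (asm) sum_fun_upd_diff[where f = "\<lambda>A. int (card A)"]) auto
    then have "?I = Y i" using fin'[of i] i by (intro card_seteq) auto
    then show ?thesis by blast
  qed
  then show thesis using that nY by blast
qed

text \<open>An increasing sequence starts from a single vertex, which then belongs to all of its nonempty
  sets. Keeping this vertex next to a given configuration therefore keeps the whole droplet in
  contact with it.\<close>

lemma nested_nucleation_seed:
  assumes nuc: "nucleation F V \<Gamma> N X" and nest: "\<And>i. i < N \<Longrightarrow> X i \<subseteq> X (Suc i)"
    and F0: "F {} = 0" and fin: "finite V"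
  obtains p v where "p \<le> N" "X p = {v}" "\<And>i. \<lbrakk>i \<le> N; X i \<noteq> {}\<rbrakk> \<Longrightarrow> v \<in> X i" "v \<in> X N"
proof -
  have N: "X N \<noteq> {}" using nuc F0 by (auto simp: nucleation_def)
  define p where "p = (LEAST i. X i \<noteq> {})"
  have p: "X p \<noteq> {}" "p \<le> N" "\<And>i. i < p \<Longrightarrow> X i = {}"
    unfolding p_def using LeastI[of "\<lambda>i. X i \<noteq> {}", OF N] Least_le[of "\<lambda>i. X i \<noteq> {}", OF N]
      not_less_Least[of _ "\<lambda>i. X i \<noteq> {}"] by blast+
  have "p \<noteq> 0" using p nuc by (auto simp: nucleation_def)
  then obtain q where q: "p = Suc q" by (cases p) auto
  then have "card (X (Suc q) - X q) \<le> 1" using nuc p(2) by (simp add: nucleation_def)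
  then have "card (X p) \<le> 1" using q p(3)[of q] by simp
  moreover have "finite (X p)" using nuc p(2) fin by (auto simp: nucleation_def intro: finite_subset)
  ultimately obtain v where v: "X p = {v}" using p(1)
    by (metis One_nat_def card_1_singletonE card_0_eq le_Suc_eq le_zero_eq)
  have mono: "X i \<subseteq> X j" if "i \<le> j" "j \<le> N" for i j
    using that
  proof (induction rule: dec_induct)
    case (step m)
    then show ?case using nest[of m] by auto
  qed simp
  have "v \<in> X i" if "i \<le> N" "X i \<noteq> {}" for i
    using mono[of p i] that p(3)[of i] v by (cases "i < p") auto
  then show thesis using that p v N by blast
qed

text \<open>The competition between \<open>A \<union> X i\<close> and \<open>A \<inter> X i\<close>. Stop as soon as one of them has lowered its
  energy, below \<open>F A\<close> and below \<open>0\<close> respectively. If only the intersection has, its history contradicts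
  the minimality of \<open>X N\<close>; hence the union has, and until then the intersection has
  nonnegative energy, which bounds the climb of the union.\<close>

lemma escape_along_union:
  assumes fin: "finite V" and sub: "submodular_on V F" and F0: "F {} = 0"
    and nz: "\<And>B. \<lbrakk>B \<subseteq> V; B \<noteq> {}\<rbrakk> \<Longrightarrow> F B \<noteq> 0"
    and nuc: "nucleation F V \<Gamma> N X" and nest: "\<And>i. i < N \<Longrightarrow> X i \<subseteq> X (Suc i)"
    and minimal: "\<And>M Y. \<lbrakk>nucleation F V \<Gamma> M Y; \<And>i. i < M \<Longrightarrow> Y i \<subseteq> Y (Suc i)\<rbrakk>
                     \<Longrightarrow> card (X N) \<le> card (Y M)"
    and v: "\<And>i. \<lbrakk>i \<le> N; X i \<noteq> {}\<rbrakk> \<Longrightarrow> v \<in> X i" "v \<in> X N"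
    and A: "A \<subseteq> V" "v \<notin> A"
    and attract: "\<And>B. \<lbrakk>v \<in> B; B \<subseteq> V; A \<inter> B = {}\<rbrakk> \<Longrightarrow> F (A \<union> B) < F A + F B"
    and \<Gamma>: "0 < \<Gamma>"
  obtains k where "k \<le> N" "F (A \<union> X k) < F A" "\<And>i. i \<le> k \<Longrightarrow> F (A \<union> X i) < F A + \<Gamma>"
proof -
  have XV: "X i \<subseteq> V" and X\<Gamma>: "F (X i) \<le> \<Gamma>" if "i \<le> N" for i
    using nuc that by (auto simp: nucleation_def)
  have sm: "F (A \<union> X i) + F (A \<inter> X i) \<le> F A + F (X i)" if "i \<le> N" for i
    using submodular_onD[OF sub A(1) XV[OF that]] .
  let ?stop = "\<lambda>i. F (A \<union> X i) < F A \<or> F (A \<inter> X i) < 0"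
  have stopN: "?stop N" using sm[of N] nuc by (auto simp: nucleation_def)
  define k where "k = (LEAST i. ?stop i)"
  have stopk: "?stop k" unfolding k_def by (rule LeastI[of ?stop, OF stopN])
  have k: "k \<le> N" unfolding k_def by (rule Least_le[of ?stop, OF stopN])
  have before: "F A \<le> F (A \<union> X i)" "0 \<le> F (A \<inter> X i)" if "i < k" for i
    using not_less_Least[of i ?stop] that unfolding k_def by auto
  have union: "F (A \<union> X k) < F A"
  proof (rule ccontr)
    \<comment> \<open>Then the intersections up to \<open>k\<close> are a competitor of \<open>X\<close> whose final set misses \<open>v\<close>.\<close>
    assume no: "\<not> F (A \<union> X k) < F A"
    have "F (A \<inter> X i) \<le> \<Gamma>" if "i \<le> k" for i
      using sm[of i] before(1)[of i] no X\<Gamma>[of i] that k by (cases "i = k") auto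
    moreover have "card (A \<inter> X (Suc i) - A \<inter> X i) \<le> 1" if "i < k" for i
    proof -
      have "card (A \<inter> X (Suc i) - A \<inter> X i) \<le> card (X (Suc i) - X i)"
        using XV[of "Suc i"] fin that k by (intro card_mono) (auto intro: finite_subset)
      moreover have "card (X (Suc i) - X i) \<le> 1" using nuc that k by (simp add: nucleation_def)
      ultimately show ?thesis by (rule order_trans)
    qed
    ultimately have "nucleation F V \<Gamma> k (\<lambda>i. A \<inter> X i)"
      using nuc A(1) stopk no by (auto simp: nucleation_def)
    moreover have "A \<inter> X i \<subseteq> A \<inter> X (Suc i)" if "i < k" for i
      using nest[of i] that k by auto
    ultimately have "card (X N) \<le> card (A \<inter> X k)"
      by (rule minimal)
    moreover have "X k \<subseteq> X N"
      using k by (induction rule: inc_induct) (use nest in fastforce)+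
    then have "card (A \<inter> X k) < card (X N)"
      using v(2) A(2) XV[of N] fin by (intro psubset_card_mono) (auto intro: finite_subset)
    ultimately show False by simp
  qed
  have "F (A \<union> X i) < F A + \<Gamma>" if "i \<le> k" for i
  proof (cases "i = k")
    case True
    then show ?thesis using union \<Gamma> by simp
  next
    case False
    then have i: "i < k" "i \<le> N" using that k by auto
    consider "X i = {}" | "v \<in> X i" "A \<inter> X i = {}" | "A \<inter> X i \<noteq> {}"
      using v(1)[OF i(2)] by blast
    then show ?thesis
    proof cases
      case 1
      then show ?thesis using \<Gamma> by simp
    next
      case 2
      then show ?thesis using attract[of "X i"] XV[OF i(2)] X\<Gamma>[OF i(2)] by simp
    next
      case 3
      then have "0 < F (A \<inter> X i)"
        using nz[of "A \<inter> X i"] A(1) before(2)[OF i(1)] by fastforce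
      then show ?thesis using sm[OF i(2)] X\<Gamma>[OF i(2)] by simp
    qed
  qed
  then show thesis using that k union by blast
qed

section \<open>The energy as edge boundary minus volume\<close>

definition boundary :: "nat \<Rightarrow> config \<Rightarrow> (nat \<Rightarrow> int) set set" where
  "boundary n A = {e \<in> cube_edges n. e \<inter> A \<noteq> {} \<and> \<not> e \<subseteq> A}"

definition excess :: "nat \<Rightarrow> real \<Rightarrow> config \<Rightarrow> real" where
  "excess n h A = hamiltonian n h A - hamiltonian n h {}"

lemma finite_cube_edges: "finite (cube_edges n)"
  by (rule finite_subset[of _ "Pow (cube_vertices n)"])
    (auto simp: cube_edges_def finite_cube_vertices)

lemma finite_boundary: "finite (boundary n A)"
  by (simp add: boundary_def finite_cube_edges)

lemma boundary_eq_edges_between: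
  assumes "A \<subseteq> cube_vertices n"
  shows "edges_between n A (cube_vertices n - A) = boundary n A"
proof (rule set_eqI)
  fix e
  show "e \<in> edges_between n A (cube_vertices n - A) \<longleftrightarrow> e \<in> boundary n A"
  proof
    assume "e \<in> boundary n A"
    then obtain x y where e: "e = {x, y}" "x \<in> cube_vertices n" "y \<in> cube_vertices n"
      and "e \<in> cube_edges n" "e \<inter> A \<noteq> {}" "\<not> e \<subseteq> A"
      by (auto simp: boundary_def cube_edges_def)
    then show "e \<in> edges_between n A (cube_vertices n - A)"
      unfolding edges_between_def by auto
  qed (auto simp: edges_between_def boundary_def)
qed

lemma excess_eq:
  assumes A: "A \<subseteq> cube_vertices n"
  shows "excess n h A = real (card (boundary n A)) - h * real (card A)"
proof -
  have "card A \<le> card (cube_vertices n)"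
    using A finite_cube_vertices by (simp add: card_mono)
  then have compl: "real (card (cube_vertices n - A)) = real (card (cube_vertices n)) - real (card A)"
    using A finite_cube_vertices finite_subset[OF A] by (simp add: card_Diff_subset of_nat_diff)
  have "edges_between n {} (cube_vertices n - {}) = {}"
    by (auto simp: edges_between_def)
  then show ?thesis
    unfolding excess_def hamiltonian_def boundary_eq_edges_between[OF A] compl
    by (simp add: field_simps)
qed

lemma excess_empty: "excess n h {} = 0"
  by (simp add: excess_def)

lemma card_boundary_sum: "real (card (boundary n A)) = 
    (\<Sum>e\<in>cube_edges n. if e \<inter> A \<noteq> {} \<and> \<not> e \<subseteq> A then 1 else 0)"
  unfolding boundary_def using finite_cube_edges by (simp add: sum.If_cases Int_def)

text \<open>Volume is modular, and the boundary is a sum over edges of the cut function of a two-point set,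
  which is submodular.\<close>

lemma excess_submodular: "submodular_on (cube_vertices n) (excess n h)"
  unfolding submodular_on_def
proof (intro allI impI)
  fix A B assume AB: "A \<subseteq> cube_vertices n" "B \<subseteq> cube_vertices n"
  have "card (A \<union> B) + card (A \<inter> B) = card A + card B"
    using AB finite_cube_vertices by (metis card_Un_Int finite_subset)
  then have c: "real (card (A \<union> B)) + real (card (A \<inter> B)) = real (card A) + real (card B)"
    by linarith
  have "real (card (boundary n (A \<union> B))) + real (card (boundary n (A \<inter> B)))
      \<le> real (card (boundary n A)) + real (card (boundary n B))"
    unfolding card_boundary_sum sum.distrib[symmetric]
    by (rule sum_mono) (auto simp: cube_edges_def)
  moreover have "A \<union> B \<subseteq> cube_vertices n" "A \<inter> B \<subseteq> cube_vertices n" using AB by auto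
  ultimately show "excess n h (A \<union> B) + excess n h (A \<inter> B) \<le> excess n h A + excess n h B"
    using AB arg_cong[OF c, of "\<lambda>x. h * x"] by (simp add: excess_eq distrib_left)
qed

text \<open>An edge between the two sets is counted in both boundaries, but is interior to the
  union.\<close>

lemma excess_union_less:
  assumes AB: "A \<subseteq> cube_vertices n" "B \<subseteq> cube_vertices n" "A \<inter> B = {}"
    and uw: "u \<in> A" "w \<in> B" "{u, w} \<in> cube_edges n"
  shows "excess n h (A \<union> B) < excess n h A + excess n h B"
proof -
  have "card (A \<union> B) = card A + card B"
    using AB finite_cube_vertices by (meson card_Un_disjoint finite_subset)
  moreover have "boundary n (A \<union> B) \<union> {{u, w}} \<subseteq> boundary n A \<union> boundary n B"
    using uw AB by (auto simp: boundary_def)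
  then have "card (insert {u, w} (boundary n (A \<union> B))) \<le> card (boundary n A \<union> boundary n B)"
    by (intro card_mono) (auto simp: boundary_def finite_cube_edges)
  moreover have "card (insert {u, w} (boundary n (A \<union> B))) = Suc (card (boundary n (A \<union> B)))"
    using uw by (intro card_insert_disjoint) (auto simp: boundary_def finite_cube_edges)
  moreover have "card (boundary n A \<union> boundary n B) \<le> card (boundary n A) + card (boundary n B)"
    by (rule card_Un_le)
  ultimately show ?thesis
    using AB by (simp add: excess_eq distrib_left)
qed

lemma card_cube_vertices: "card (cube_vertices n) = 2 ^ n"
  by (simp add: cube_vertices_def card_PiE numeral_2_eq_2)

text \<open>Zero excess would exhibit \<open>h\<close> as boundary size over volume.\<close>

lemma excess_nonzero:
  assumes h: "\<not> (\<exists>a b :: nat. b \<in> {1..2 ^ n} \<and> h = real a / real b)"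
    and B: "B \<subseteq> cube_vertices n" "B \<noteq> {}"
  shows "excess n h B \<noteq> 0"
proof
  assume 0: "excess n h B = 0"
  have fin: "finite B" using B finite_cube_vertices finite_subset by blast
  then have pos: "0 < card B" using B by (simp add: card_gt_0_iff)
  have "card B \<le> 2 ^ n"
    using card_mono[OF finite_cube_vertices B(1)] by (simp add: card_cube_vertices)
  moreover have "h = real (card (boundary n B)) / real (card B)"
    using 0 pos B by (simp add: excess_eq field_simps)
  ultimately show False using h pos by (metis One_nat_def Suc_leI atLeastAtMost_iff)
qed

section \<open>Geometry of the hypercube\<close>

lemma flip_in_cube:
  assumes "v \<in> cube_vertices n" "i < n" "b \<in> {0, 1}"
  shows "v(i := b) \<in> cube_vertices n"
  using assms by (auto simp: cube_vertices_def PiE_def Pi_def extensional_def)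

lemma flip_edge:
  assumes v: "v \<in> cube_vertices n" and i: "i < n"
  shows "{v, v(i := 1 - v i)} \<in> cube_edges n"
proof -
  have vi: "v i \<in> {0, 1}" using v i by (auto simp: cube_vertices_def)
  have "(\<Sum>j<n. \<bar>v j - (v(i := 1 - v i)) j\<bar>) = (\<Sum>j<n. if j = i then 1 else 0)"
    using vi by (intro sum.cong) auto
  also have "\<dots> = 1" using i by simp
  finally have "(\<Sum>j<n. \<bar>v j - (v(i := 1 - v i)) j\<bar>) = 1" .
  moreover have "v(i := 1 - v i) \<in> cube_vertices n"
    using vi by (intro flip_in_cube[OF v i]) auto
  ultimately show ?thesis unfolding cube_edges_def using v by blast
qed

text \<open>The \<open>n\<close> flips of \<open>v\<close> give \<open>n\<close> boundary edges.\<close>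

lemma excess_singleton_pos:
  assumes "h < real n" and v: "v \<in> cube_vertices n"
  shows "0 < excess n h {v}"
proof -
  let ?g = "\<lambda>i. {v, v(i := 1 - v i)}"
  have ne: "v(i := 1 - v i) \<noteq> v" if "i < n" for i
    using v that by (auto simp: fun_upd_def fun_eq_iff dest!: spec[of _ i]) presburger
  have "inj_on ?g {..<n}"
  proof (rule inj_onI)
    fix i j assume ij: "i \<in> {..<n}" "j \<in> {..<n}" "?g i = ?g j"
    then have "v(i := 1 - v i) = v(j := 1 - v j)"
      using ne[of i] ne[of j] by (auto simp: doubleton_eq_iff)
    then have "(v(j := 1 - v j)) i = 1 - v i" by (metis fun_upd_same)
    then show "i = j" by (auto split: if_splits) presburger
  qed
  then have "card (?g ` {..<n}) = n" by (simp add: card_image)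
  moreover have "?g ` {..<n} \<subseteq> boundary n {v}"
    using flip_edge[OF v] ne by (auto simp: boundary_def)
  ultimately have "n \<le> card (boundary n {v})"
    using card_mono[OF finite_boundary] by metis
  then show ?thesis using assms by (simp add: excess_eq)
qed

text \<open>Take a vertex inside and one outside at minimal Hamming distance. Moving the inner one a step towards
  the outer one must leave \<open>A\<close>, or the distance could be reduced.\<close>

lemma cube_connected:
  assumes A: "A \<subseteq> cube_vertices n" "A \<noteq> {}" "A \<noteq> cube_vertices n"
  obtains a w where "a \<in> A" "w \<in> cube_vertices n" "w \<notin> A" "{a, w} \<in> cube_edges n"
proof -
  define D where "D = (\<lambda>(a, b). card {i. i < n \<and> a i \<noteq> (b i :: int)})"
  obtain a b where ab: "a \<in> A" "b \<in> cube_vertices n - A"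
    and least: "\<And>a' b'. \<lbrakk>a' \<in> A; b' \<in> cube_vertices n - A\<rbrakk> \<Longrightarrow> D (a, b) \<le> D (a', b')"
  proof -
    obtain a0 b0 where "(a0, b0) \<in> A \<times> (cube_vertices n - A)" using A by auto
    from ex_has_least_nat[of "\<lambda>p. p \<in> A \<times> (cube_vertices n - A)", OF this, of D]
    show thesis using that by auto
  qed
  have aV: "a \<in> cube_vertices n" and bV: "b \<in> cube_vertices n" using ab A by auto
  have "a \<noteq> b" using ab by auto
  then obtain i where i: "i < n" "a i \<noteq> b i"
    using PiE_ext[OF aV[unfolded cube_vertices_def] bV[unfolded cube_vertices_def]] by blast
  have "a i \<in> {0, 1}" "b i \<in> {0, 1}" using aV bV i by (auto simp: cube_vertices_def)
  then have bi: "b i = 1 - a i" using i by auto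
  let ?c = "a(i := 1 - a i)"
  have "{j. j < n \<and> ?c j \<noteq> b j} \<subset> {j. j < n \<and> a j \<noteq> b j}"
  proof (rule psubsetI)
    show "{j. j < n \<and> ?c j \<noteq> b j} \<subseteq> {j. j < n \<and> a j \<noteq> b j}"
      using i(2) by (intro Collect_mono) (metis fun_upd_other)
    have "i \<in> {j. j < n \<and> a j \<noteq> b j}" "i \<notin> {j. j < n \<and> ?c j \<noteq> b j}"
      using i bi by simp_all
    then show "{j. j < n \<and> ?c j \<noteq> b j} \<noteq> {j. j < n \<and> a j \<noteq> b j}" by metis
  qed
  then have "D (?c, b) < D (a, b)"
    unfolding D_def prod.case by (rule psubset_card_mono[rotated]) simp
  then have "?c \<notin> A" using least[of ?c b] ab by auto
  moreover have "?c \<in> cube_vertices n"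
    using flip_in_cube[OF aV i(1), of "b i"] \<open>b i \<in> {0, 1}\<close> bi by simp
  ultimately show thesis using that ab(1) flip_edge[OF aV i(1)] by blast
qed

text \<open>In the vector space over the two-element field this is \<open>x \<mapsto> x + v + w\<close>. The restriction to
  \<open>{..<n}\<close> gives the values outside the index set that vertices are required to have.\<close>

definition translate :: "nat \<Rightarrow> (nat \<Rightarrow> int) \<Rightarrow> (nat \<Rightarrow> int) \<Rightarrow> (nat \<Rightarrow> int) \<Rightarrow> nat \<Rightarrow> int" where
  "translate n v w x = (\<lambda>i\<in>{..<n}. if v i = w i then x i else 1 - x i)"

lemma translate_in_cube: "x \<in> cube_vertices n \<Longrightarrow> translate n v w x \<in> cube_vertices n"
  by (auto simp: translate_def cube_vertices_def PiE_def Pi_def)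

lemma translate_involution:
  assumes "x \<in> cube_vertices n"
  shows "translate n v w (translate n v w x) = x"
  using assms by (force simp: translate_def cube_vertices_def PiE_def extensional_def)

lemma translate_moves:
  assumes "v \<in> cube_vertices n" "w \<in> cube_vertices n"
  shows "translate n v w v = w"
proof
  fix i
  show "translate n v w v i = w i"
  proof (cases "i < n")
    case True
    then have "v i \<in> {0, 1}" "w i \<in> {0, 1}" using assms by (auto simp: cube_vertices_def)
    then show ?thesis using True by (auto simp: translate_def)
  qed (use assms in \<open>auto simp: translate_def cube_vertices_def PiE_def extensional_def\<close>)
qed

lemma translate_edge:
  assumes "e \<in> cube_edges n"
  shows "translate n v w ` e \<in> cube_edges n"
proof -
  obtain x y where e: "e = {x, y}" and xy: "x \<in> cube_vertices n" "y \<in> cube_vertices n"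
      "(\<Sum>i<n. \<bar>x i - y i\<bar>) = 1"
    using assms by (auto simp: cube_edges_def)
  have "(\<Sum>i<n. \<bar>translate n v w x i - translate n v w y i\<bar>) = (\<Sum>i<n. \<bar>x i - y i\<bar>)"
    by (intro sum.cong) (auto simp: translate_def)
  then have "(\<Sum>i<n. \<bar>translate n v w x i - translate n v w y i\<bar>) = 1" using xy(3) by simp
  then show ?thesis
    unfolding cube_edges_def e image_insert image_empty
    using translate_in_cube[OF xy(1)] translate_in_cube[OF xy(2)] by blast
qed

lemma inj_on_translate: "inj_on (translate n v w) (cube_vertices n)"
  by (rule inj_on_inverseI[where g = "translate n v w"]) (rule translate_involution)

lemma translate_image_cube:
  "A \<subseteq> cube_vertices n \<Longrightarrow> translate n v w ` A \<subseteq> cube_vertices n"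
  using translate_in_cube by auto

text \<open>One inequality suffices for invariance, since a translation is its own inverse.\<close>

lemma card_boundary_translate_ge:
  assumes A: "A \<subseteq> cube_vertices n"
  shows "card (boundary n A) \<le> card (boundary n (translate n v w ` A))"
proof (rule card_inj_on_le)
  let ?g = "translate n v w"
  have eV: "e \<subseteq> cube_vertices n" if "e \<in> boundary n B" for e B
    using that by (auto simp: boundary_def cube_edges_def)
  show "inj_on ((`) ?g) (boundary n A)"
    using inj_on_image_eq_iff[OF inj_on_translate] eV by (intro inj_onI) metis
  show "(`) ?g ` boundary n A \<subseteq> boundary n (?g ` A)"
  proof (rule image_subsetI)
    fix e assume e: "e \<in> boundary n A"
    then have "\<not> ?g ` e \<subseteq> ?g ` A"
      using inj_on_image_mem_iff[OF inj_on_translate _ A] eV[OF e]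
      by (auto simp: boundary_def subset_iff)
    then show "?g ` e \<in> boundary n (?g ` A)"
      using e translate_edge by (auto simp: boundary_def)
  qed
  show "finite (boundary n (?g ` A))" by (simp add: boundary_def finite_cube_edges)
qed

lemma excess_translate:
  assumes A: "A \<subseteq> cube_vertices n"
  shows "excess n h (translate n v w ` A) = excess n h A"
proof -
  let ?g = "translate n v w"
  have "?g ` ?g ` A = A"
    using translate_involution A by (simp add: image_image subset_iff)
  then have "card (boundary n (?g ` A)) = card (boundary n A)"
    using card_boundary_translate_ge[OF A, of v w]
      card_boundary_translate_ge[OF translate_image_cube[OF A], of v w v w] by simp
  moreover have "card (?g ` A) = card A"
    using A inj_on_translate by (intro card_image) (rule inj_on_subset)
  ultimately show ?thesis by (simp add: excess_eq[OF A] excess_eq[OF translate_image_cube[OF A]])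
qed

lemma nucleation_translate:
  assumes "nucleation (excess n h) (cube_vertices n) \<Gamma> N X"
  shows "nucleation (excess n h) (cube_vertices n) \<Gamma> N (\<lambda>i. translate n v w ` X i)"
proof -
  let ?g = "translate n v w"
  have X: "X i \<subseteq> cube_vertices n" if "i \<le> N" for i using assms that by (simp add: nucleation_def)
  have "card (?g ` X (Suc i) - ?g ` X i) \<le> 1" if "i < N" for i
  proof -
    have "?g ` X (Suc i) - ?g ` X i = ?g ` (X (Suc i) - X i)"
      using X[of i] X[of "Suc i"] that
      by (intro inj_on_image_set_diff[OF inj_on_translate, symmetric]) auto
    moreover have "card (?g ` (X (Suc i) - X i)) \<le> card (X (Suc i) - X i)"
      using X[of "Suc i"] that finite_cube_vertices by (intro card_image_le) (auto intro: finite_subset)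
    moreover have "card (X (Suc i) - X i) \<le> 1" using assms that by (simp add: nucleation_def)
    ultimately show ?thesis by simp
  qed
  then show ?thesis
    using assms translate_image_cube by (auto simp: nucleation_def excess_translate)
qed

section \<open>Stability levels\<close>

lemma stability_level_attained:
  assumes "\<xi> \<in> configs n" "\<zeta> \<in> configs n" "hamiltonian n h \<zeta> < hamiltonian n h \<xi>"
  obtains \<eta> \<gamma> where "is_path n \<xi> \<eta> \<gamma>" "\<eta> \<in> configs n" "hamiltonian n h \<eta> < hamiltonian n h \<xi>"
    "stability_level n h \<xi> = Max (hamiltonian n h ` set \<gamma>) - hamiltonian n h \<xi>"
proof -
  let ?L = "{comm_height n h \<xi> \<zeta> | \<zeta>. \<zeta> \<in> configs n \<and> hamiltonian n h \<zeta> < hamiltonian n h \<xi>}"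
  have "Min ?L \<in> ?L" using assms by (intro Min_in finite_stability_values) auto
  then obtain \<eta> where \<eta>: "\<eta> \<in> configs n" "hamiltonian n h \<eta> < hamiltonian n h \<xi>"
    "Min ?L = comm_height n h \<xi> \<eta>" by auto
  let ?P = "{Max (hamiltonian n h ` set \<gamma>) | \<gamma>. is_path n \<xi> \<eta> \<gamma>}"
  have "Min ?P \<in> ?P"
    using is_path_exists[OF assms(1) \<eta>(1)] by (intro Min_in finite_comm_height_values) auto
  then obtain \<gamma> where "is_path n \<xi> \<eta> \<gamma>" "comm_height n h \<xi> \<eta> = Max (hamiltonian n h ` set \<gamma>)"
    unfolding comm_height_def by auto
  then show thesis using that \<eta> by (simp add: stability_level_def)
qed

lemma stability_level_less:
  assumes p: "is_path n \<xi> \<eta> \<gamma>" and lower: "hamiltonian n h \<eta> < hamiltonian n h \<xi>"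
    and height: "\<And>\<sigma>. \<sigma> \<in> set \<gamma> \<Longrightarrow> hamiltonian n h \<sigma> < hamiltonian n h \<xi> + \<Gamma>"
  shows "stability_level n h \<xi> < \<Gamma>"
proof -
  have \<eta>: "\<eta> \<in> configs n" using p last_in_set by (force simp: is_path_def)
  have "Min {comm_height n h \<xi> \<zeta> | \<zeta>. \<zeta> \<in> configs n \<and> hamiltonian n h \<zeta> < hamiltonian n h \<xi>}
      \<le> comm_height n h \<xi> \<eta>"
    using \<eta> lower by (intro Min_le finite_stability_values) auto
  also have "\<dots> \<le> Max (hamiltonian n h ` set \<gamma>)"
    unfolding comm_height_def using p by (intro Min_le finite_comm_height_values) auto
  also have "\<dots> < hamiltonian n h \<xi> + \<Gamma>"
    using p height by (subst Max_less_iff) (auto simp: is_path_def)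
  finally show ?thesis by (simp add: stability_level_def)
qed

lemma path_gives_nucleation:
  assumes p: "is_path n {} \<eta> \<gamma>" and lower: "hamiltonian n h \<eta> < hamiltonian n h {}"
    and \<Gamma>: "\<Gamma> = Max (hamiltonian n h ` set \<gamma>) - hamiltonian n h {}"
  shows "nucleation (excess n h) (cube_vertices n) \<Gamma> (length \<gamma> - 1) (\<lambda>i. \<gamma> ! i)"
proof -
  have ne: "\<gamma> \<noteq> []" using p by (simp add: is_path_def)
  have mem: "\<gamma> ! i \<in> set \<gamma>" if "i \<le> length \<gamma> - 1" for i
    using ne that by (cases \<gamma>) (auto intro!: nth_mem simp del: set_simps)
  have V: "\<gamma> ! i \<subseteq> cube_vertices n" if "i \<le> length \<gamma> - 1" for i
    using mem[OF that] p by (auto simp: is_path_def configs_def)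
  have "excess n h (\<gamma> ! i) \<le> \<Gamma>" if "i \<le> length \<gamma> - 1" for i
    unfolding excess_def \<Gamma> using mem[OF that] by simp
  moreover have "card (\<gamma> ! Suc i - \<gamma> ! i) \<le> 1" if i: "i < length \<gamma> - 1" for i
  proof -
    have "card (sym_diff (\<gamma> ! i) (\<gamma> ! Suc i)) = 1"
      using p i by (auto simp: is_path_def successively_conv_nth)
    moreover from this have "finite (sym_diff (\<gamma> ! i) (\<gamma> ! Suc i))"
      by (intro card_ge_0_finite) simp
    then have "card (\<gamma> ! Suc i - \<gamma> ! i) \<le> card (sym_diff (\<gamma> ! i) (\<gamma> ! Suc i))"
      by (rule card_mono) blast
    ultimately show ?thesis by simp
  qed
  moreover have "\<gamma> ! 0 = {}" "\<gamma> ! (length \<gamma> - 1) = \<eta>"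
    using p by (auto simp: is_path_def hd_conv_nth last_conv_nth)
  ultimately show ?thesis
    using V lower by (auto simp: nucleation_def excess_def)
qed

text \<open>Steps that add no vertex outside \<open>A\<close> change nothing and are skipped, since
  consecutive configurations of a path have to differ.\<close>

lemma path_along_union:
  assumes A: "A \<in> configs n"
    and X: "X 0 = {}" "\<And>i. i \<le> k \<Longrightarrow> X i \<subseteq> cube_vertices n"
      "\<And>i. i < k \<Longrightarrow> card (X (Suc i) - X i) \<le> 1" "\<And>i. i < k \<Longrightarrow> X i \<subseteq> X (Suc i)"
  shows "\<exists>\<gamma>. is_path n A (A \<union> X k) \<gamma> \<and> set \<gamma> \<subseteq> (\<lambda>i. A \<union> X i) ` {..k}"
  using X
proof (induction k)
  case 0
  then show ?case using A by (intro exI[of _ "[A]"]) (auto simp: is_path_def)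
next
  case (Suc k)
  then obtain \<gamma> where \<gamma>: "is_path n A (A \<union> X k) \<gamma>" "set \<gamma> \<subseteq> (\<lambda>i. A \<union> X i) ` {..k}"
    by (metis le_Suc_eq less_Suc_eq)
  let ?D = "sym_diff (A \<union> X k) (A \<union> X (Suc k))"
  have nest: "X k \<subseteq> X (Suc k)" and c: "card (X (Suc k) - X k) \<le> 1" using Suc.prems by auto
  have "finite (X (Suc k) - X k)"
    using Suc.prems(2)[of "Suc k"] finite_cube_vertices by (auto intro: finite_subset)
  moreover have sub: "?D \<subseteq> X (Suc k) - X k" using nest by auto
  ultimately have D: "card ?D \<le> 1" "finite ?D"
    using c by (meson card_mono order_trans, meson finite_subset)
  show ?case
  proof (cases "?D = {}")
    case True
    then have "A \<union> X (Suc k) = A \<union> X k" using nest by auto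
    then show ?thesis using \<gamma> by (intro exI[of _ \<gamma>]) auto
  next
    case False
    then have "card ?D = 1" using D by (metis One_nat_def card_0_eq le_Suc_eq le_zero_eq)
    moreover have "A \<union> X (Suc k) \<in> configs n"
      using A Suc.prems(2)[of "Suc k"] by (auto simp: configs_def)
    ultimately have "is_path n A (A \<union> X (Suc k)) (\<gamma> @ [A \<union> X (Suc k)])"
      by (intro is_path_extend[OF \<gamma>(1)])
    then show ?thesis using \<gamma>(2) by (intro exI[of _ "\<gamma> @ [A \<union> X (Suc k)]"]) auto
  qed
qed

lemma stability_level_less_all_minus:
  assumes h: "0 < h" "h < real n" "\<not> (\<exists>a b :: nat. b \<in> {1..2 ^ n} \<and> h = real a / real b)"
    and A: "A \<in> configs n" "A \<noteq> {}" "A \<noteq> all_plus n"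
  shows "stability_level n h A < stability_level n h {}"
proof -
  let ?F = "excess n h" and ?V = "cube_vertices n" and ?\<Gamma> = "stability_level n h {}"
  let ?nested = "\<lambda>(N, X). nucleation ?F ?V ?\<Gamma> N X \<and> (\<forall>i<N. X i \<subseteq> X (Suc i))"
  have AV: "A \<subseteq> ?V" "A \<noteq> ?V" using A by (auto simp: configs_def all_plus_def)
  have "hamiltonian n h (all_plus n) < hamiltonian n h {}"
    using all_minus_in_configs[of n] h(1) by (intro all_plus_minimizer) (auto simp: all_minus_def)
  moreover have "{} \<in> configs n" "all_plus n \<in> configs n" by (auto simp: configs_def all_plus_def)
  ultimately obtain \<eta> \<gamma> where "is_path n {} \<eta> \<gamma>" "hamiltonian n h \<eta> < hamiltonian n h {}"
      "?\<Gamma> = Max (hamiltonian n h ` set \<gamma>) - hamiltonian n h {}"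
    by (metis stability_level_attained)
  from path_gives_nucleation[OF this]
  obtain Y where "?nested (length \<gamma> - 1, Y)"
    using nested_nucleation_exists[OF finite_cube_vertices excess_submodular] by blast
  \<comment> \<open>Choose the length and the sequence together so that the final set is smallest.\<close>
  then have "\<exists>p. ?nested p \<and> (\<forall>q. ?nested q \<longrightarrow> card (snd p (fst p)) \<le> card (snd q (fst q)))"
    by (rule ex_has_least_nat)
  then obtain N X where nuc: "nucleation ?F ?V ?\<Gamma> N X"
    and nest: "\<And>i. i < N \<Longrightarrow> X i \<subseteq> X (Suc i)"
    and minimal: "\<And>M Y. \<lbrakk>nucleation ?F ?V ?\<Gamma> M Y; \<And>i. i < M \<Longrightarrow> Y i \<subseteq> Y (Suc i)\<rbrakk>
                    \<Longrightarrow> card (X N) \<le> card (Y M)"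
    by fastforce
  obtain p v where p: "p \<le> N" "X p = {v}"
    and v: "\<And>i. \<lbrakk>i \<le> N; X i \<noteq> {}\<rbrakk> \<Longrightarrow> v \<in> X i" "v \<in> X N"
    using nested_nucleation_seed[OF nuc nest excess_empty finite_cube_vertices] by metis
  have vV: "v \<in> ?V" using nuc v(2) by (auto simp: nucleation_def)
  have "0 < ?F {v}" using excess_singleton_pos[OF h(2) vV] .
  also have "\<dots> \<le> ?\<Gamma>" using nuc p by (auto simp: nucleation_def)
  finally have \<Gamma>: "0 < ?\<Gamma>" .
  \<comment> \<open>The seed \<open>v\<close> of the smallest droplet is moved to a vertex \<open>w\<close> just outside \<open>A\<close>.\<close>
  obtain a w where aw: "a \<in> A" "w \<in> ?V" "w \<notin> A" "{a, w} \<in> cube_edges n"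
    using cube_connected[OF AV(1) A(2) AV(2)] .
  define Z where "Z = (\<lambda>i. translate n v w ` X i)"
  have nucZ: "nucleation ?F ?V ?\<Gamma> N Z" unfolding Z_def by (rule nucleation_translate[OF nuc])
  have nestZ: "\<And>i. i < N \<Longrightarrow> Z i \<subseteq> Z (Suc i)" unfolding Z_def by (rule image_mono[OF nest])
  have cardZ: "card (Z N) = card (X N)"
    unfolding Z_def using nuc
    by (intro card_image inj_on_subset[OF inj_on_translate]) (simp add: nucleation_def)
  have w: "w \<in> Z i" if "i \<le> N" "Z i \<noteq> {}" for i
    using v(1)[of i] that translate_moves[OF vV aw(2)] unfolding Z_def by force
  have wN: "w \<in> Z N" using v(2) translate_moves[OF vV aw(2)] unfolding Z_def by force
  obtain k where k: "k \<le> N" "?F (A \<union> Z k) < ?F A"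
    and height: "\<And>i. i \<le> k \<Longrightarrow> ?F (A \<union> Z i) < ?F A + ?\<Gamma>"
  proof (rule escape_along_union[OF finite_cube_vertices excess_submodular excess_empty
        excess_nonzero[OF h(3)] nucZ nestZ _ w wN AV(1) aw(3) _ \<Gamma>])
    show "card (Z N) \<le> card (Y M)"
      if "nucleation ?F ?V ?\<Gamma> M Y" "\<And>i. i < M \<Longrightarrow> Y i \<subseteq> Y (Suc i)" for M Y
      using minimal[OF that] cardZ by simp
    show "?F (A \<union> B) < ?F A + ?F B" if "w \<in> B" "B \<subseteq> ?V" "A \<inter> B = {}" for B
      using excess_union_less[OF AV(1) that(2,3) aw(1) that(1) aw(4)] .
  qed blast+
  have "\<exists>\<gamma>. is_path n A (A \<union> Z k) \<gamma> \<and> set \<gamma> \<subseteq> (\<lambda>i. A \<union> Z i) ` {..k}"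
    using nucZ nestZ k(1) by (intro path_along_union[OF A(1)]) (auto simp: nucleation_def)
  then obtain \<gamma>' where \<gamma>': "is_path n A (A \<union> Z k) \<gamma>'" "set \<gamma>' \<subseteq> (\<lambda>i. A \<union> Z i) ` {..k}"
    by blast
  show ?thesis
  proof (rule stability_level_less[OF \<gamma>'(1)])
    show "hamiltonian n h (A \<union> Z k) < hamiltonian n h A" using k(2) by (simp add: excess_def)
    show "hamiltonian n h \<sigma> < hamiltonian n h A + ?\<Gamma>" if "\<sigma> \<in> set \<gamma>'" for \<sigma>
      using \<gamma>'(2) that height by (force simp: excess_def)
  qed
qed

theorem theorem3:
  fixes n :: nat and h :: real
  assumes "0 < h" and "h < real n"
    and "\<not> (\<exists>a b :: nat. b \<in> {1..2 ^ n} \<and> h = real a / real b)"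
  shows "metastable n h = {all_minus}"
proof -
  let ?S = "configs n - {all_plus n}"
  have less: "stability_level n h A < stability_level n h all_minus"
    if "A \<in> ?S" "A \<noteq> all_minus" for A
    using stability_level_less_all_minus[OF assms] that by (simp add: all_minus_def)
  have "Max (stability_level n h ` ?S) = stability_level n h all_minus"
  proof (rule Max_eqI)
    show "finite (stability_level n h ` ?S)" by (simp add: finite_configs)
    show "stability_level n h all_minus \<in> stability_level n h ` ?S"
      using all_minus_in_configs by blast
    show "y \<le> stability_level n h all_minus" if "y \<in> stability_level n h ` ?S" for y
      using that less by force
  qed
  then show ?thesis
    unfolding metastable_def using less all_minus_in_configs by fastforce
qed

end
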